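(* Let $m,k\ge 2$ be integers, and let $f$ be defined by $f(0)=1$ and $f(r)=f(r-1)+\left\lceil \frac{f(r-1)}{m-1}\right\rceil$ for $r\ge 1$. Then \[ \chi_{P}\bigl(K_{(m(k+1)f(k))\star m}\bigr) > k , \] where $K_{(m(k+1)f(k))\star m}$ is the complete multipartite graph with $m$ parts, each of size $m(k+1)f(k)$.
   Context: Complete multipartite graphs: $K_{a\star b}$ is the graph whose vertex set is partitioned into $b$ independent sets (parts), each of size $a$, with every two vertices in different parts adjacent. Paintability: for a finite simple graph $G$ and an integer $r\ge 1$, the on-line list coloring game with threshold $r$ is played by Lister and Painter in rounds, all vertices being initially unpainted. In round $i$, Lister chooses a nonempty set $S\subseteq V(G)$ of currently unpainted vertices and presents it to Painter; then Painter chooses an independent set $I\subseteq S$ and paints all vertices of $I$ with color $i$. At the end of a round, Painter wins if all vertices have been painted, and Lister wins if some unpainted vertex has been presented at least $r$ times. $G$ is $r$-paintable if Painter has a winning strategy with threshold $r$, and the paintability $\chi_P(G)$ is the minimum $r$ such that $G$ is $r$-paintable. *)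

theory Defs
  imports Complex_Main "Graph_Theory.Pair_Digraph"
begin

text \<open>
  Finite simple graphs are the library's \<^locale>\<open>pair_graph\<close>s: finite, symmetric and loop-free,
  with an edge between u and v represented by the two arcs (u, v) and (v, u).
\<close>

definition independent_set :: "'a pair_pre_digraph \<Rightarrow> 'a set \<Rightarrow> bool" where
  "independent_set G I \<longleftrightarrow> I \<subseteq> pverts G \<and> (\<forall>u\<in>I. \<forall>v\<in>I. (u, v) \<notin> parcs G)"

text \<open>\<open>complete_multipartite a b\<close> has b parts of size a; the vertex (i, j) is the j-th vertex of
  part i.\<close>

definition complete_multipartite :: "nat \<Rightarrow> nat \<Rightarrow> (nat \<times> nat) pair_pre_digraph" where
  "complete_multipartite a b =
     \<lparr> pverts = {..<b} \<times> {..<a},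
       parcs = {(u, v). u \<in> {..<b} \<times> {..<a} \<and> v \<in> {..<b} \<times> {..<a} \<and> fst u \<noteq> fst v} \<rparr>"

lemma pair_graph_complete_multipartite: "pair_graph (complete_multipartite a b)"
proof -
  have "parcs (complete_multipartite a b) \<subseteq> ({..<b} \<times> {..<a}) \<times> ({..<b} \<times> {..<a})"
    by (auto simp: complete_multipartite_def)
  then have "finite (parcs (complete_multipartite a b))"
    by (rule finite_subset) simp
  moreover have "symmetric (with_proj (complete_multipartite a b))"
    by (auto simp: symmetric_def complete_multipartite_def intro: symI)
  ultimately show ?thesis
    by unfold_locales (auto simp: complete_multipartite_def)
qed

text \<open>
  A history h is the chronological list of the sets presented by Lister. A strategy \<open>\<sigma>\<close> for Painter
  maps a nonempty history to the set painted in response to its last entry; Painter's earlier moves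
  are determined by \<open>\<sigma>\<close> and need not be recorded.
\<close>

definition unpainted :: "'a pair_pre_digraph \<Rightarrow> ('a set list \<Rightarrow> 'a set) \<Rightarrow> 'a set list \<Rightarrow> 'a set" where
  "unpainted G \<sigma> h = pverts G - (\<Union>i<length h. \<sigma> (take (Suc i) h))"

definition presentations :: "'a set list \<Rightarrow> 'a \<Rightarrow> nat" where
  "presentations h v = card {i. i < length h \<and> v \<in> h ! i}"

definition lister_has_won ::
    "'a pair_pre_digraph \<Rightarrow> nat \<Rightarrow> ('a set list \<Rightarrow> 'a set) \<Rightarrow> 'a set list \<Rightarrow> bool" where
  "lister_has_won G r \<sigma> h \<longleftrightarrow> (\<exists>v\<in>unpainted G \<sigma> h. presentations h v \<ge> r)"

definition painter_has_won ::
    "'a pair_pre_digraph \<Rightarrow> ('a set list \<Rightarrow> 'a set) \<Rightarrow> 'a set list \<Rightarrow> bool" where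
  "painter_has_won G \<sigma> h \<longleftrightarrow> unpainted G \<sigma> h = {}"

text \<open>The histories that can arise, before or at the end of the game, when Painter follows \<open>\<sigma>\<close>.\<close>

inductive lister_play ::
    "'a pair_pre_digraph \<Rightarrow> nat \<Rightarrow> ('a set list \<Rightarrow> 'a set) \<Rightarrow> 'a set list \<Rightarrow> bool"
  for G r \<sigma> where
  start: "lister_play G r \<sigma> []"
| round: "lister_play G r \<sigma> h \<Longrightarrow> \<not> lister_has_won G r \<sigma> h \<Longrightarrow> \<not> painter_has_won G \<sigma> h \<Longrightarrow>
    S \<noteq> {} \<Longrightarrow> S \<subseteq> unpainted G \<sigma> h \<Longrightarrow> lister_play G r \<sigma> (h @ [S])"

text \<open>All responses are legal moves, every play that cannot be continued is won by Painter, and no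
  play goes on forever.\<close>

definition painter_winning_strategy ::
    "'a pair_pre_digraph \<Rightarrow> nat \<Rightarrow> ('a set list \<Rightarrow> 'a set) \<Rightarrow> bool" where
  "painter_winning_strategy G r \<sigma> \<longleftrightarrow>
     (\<forall>h S. lister_play G r \<sigma> (h @ [S]) \<longrightarrow>
        \<sigma> (h @ [S]) \<subseteq> S \<and> independent_set G (\<sigma> (h @ [S]))) \<and>
     (\<forall>h. lister_play G r \<sigma> h \<and> (\<nexists>S. lister_play G r \<sigma> (h @ [S])) \<longrightarrow> painter_has_won G \<sigma> h) \<and>
     (\<nexists>S :: nat \<Rightarrow> 'a set. \<forall>n. lister_play G r \<sigma> (map S [0..<n]))"

definition paintable :: "'a pair_pre_digraph \<Rightarrow> nat \<Rightarrow> bool" where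
  "paintable G r \<longleftrightarrow> (\<exists>\<sigma>. painter_winning_strategy G r \<sigma>)"

definition paintability :: "'a pair_pre_digraph \<Rightarrow> nat" where
  "paintability G = (LEAST r. r \<ge> 1 \<and> paintable G r)"

lemma lister_play_nthD:
  assumes "lister_play G r \<sigma> h"
  shows "i < length h \<Longrightarrow> lister_play G r \<sigma> (take (Suc i) h) \<and> h ! i \<noteq> {} \<and> h ! i \<subseteq> unpainted G \<sigma> (take i h)"
  using assms
proof (induction arbitrary: i)
  case start then show ?case by simp
next
  case (round h S)
  show ?case
  proof (cases "i < length h")
    case True then show ?thesis using round by (auto simp: nth_append)
  next
    case False
    then have "i = length h" using round.prems by simp
    then show ?thesis using round lister_play.round[OF round.hyps] by simp
  qed
qed

text \<open>The minimum in \<open>paintability\<close> exists: Painter may always paint a single vertex.\<close>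

lemma ex_paintable:
  assumes "pair_graph G"
  shows "\<exists>r\<ge>1. paintable G r"
proof -
  interpret pair_graph G by fact
  define \<sigma> :: "'a set list \<Rightarrow> 'a set" where "\<sigma> h = {SOME v. v \<in> last h}" for h
  define r where "r = Suc (card (pverts G))"
  have resp: "\<sigma> (take (Suc i) h) \<subseteq> h ! i" if "lister_play G r \<sigma> h" "i < length h" for h i
  proof -
    have "h ! i \<noteq> {}" using lister_play_nthD[OF that] by blast
    moreover have "last (take (Suc i) h) = h ! i" using that(2)
      by (simp add: take_Suc_conv_app_nth)
    ultimately show ?thesis by (simp add: \<sigma>_def some_in_eq)
  qed
  have len: "length h + card (unpainted G \<sigma> h) = card (pverts G)" if "lister_play G r \<sigma> h" for h
    using that
  proof (induction)
    case start then show ?case by (simp add: unpainted_def)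
  next
    case (round h S)
    have p: "lister_play G r \<sigma> (h @ [S])" using lister_play.round[OF round.hyps] .
    obtain v where v: "\<sigma> (h @ [S]) = {v}" by (auto simp: \<sigma>_def)
    have "v \<in> S" using resp[OF p, of "length h"] v by simp
    then have vu: "v \<in> unpainted G \<sigma> h" using round.hyps by auto
    have "unpainted G \<sigma> (h @ [S]) = unpainted G \<sigma> h - {v}"
      by (auto simp: unpainted_def lessThan_Suc v)
    moreover have "finite (unpainted G \<sigma> h)" by (simp add: unpainted_def)
    ultimately have "Suc (card (unpainted G \<sigma> (h @ [S]))) = card (unpainted G \<sigma> h)"
      using vu by (metis card.remove)
    then show ?case using round.IH by simp
  qed
  have pres: "presentations h v \<le> length h" for h :: "'a set list" and v
    unfolding presentations_def
    by (rule order_trans[OF card_mono[of "{..<length h}"]]) auto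
  have nl: "\<not> lister_has_won G r \<sigma> h" if "lister_play G r \<sigma> h" for h
    using len[OF that] le_trans[OF _ pres[of h]] unfolding lister_has_won_def r_def by fastforce
  have "painter_winning_strategy G r \<sigma>"
    unfolding painter_winning_strategy_def
  proof (intro conjI allI impI notI)
    fix h S assume p: "lister_play G r \<sigma> (h @ [S])"
    show "\<sigma> (h @ [S]) \<subseteq> S" using resp[OF p, of "length h"] by simp
    moreover have "S \<subseteq> pverts G" using lister_play_nthD[OF p, of "length h"]
      by (auto simp: unpainted_def)
    ultimately show "independent_set G (\<sigma> (h @ [S]))"
      using pair_no_loops unfolding independent_set_def \<sigma>_def by fastforce
  next
    fix h assume "lister_play G r \<sigma> h \<and> (\<nexists>S. lister_play G r \<sigma> (h @ [S]))"
    then show "painter_has_won G \<sigma> h"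
      using nl lister_play.round[of G r \<sigma> h "unpainted G \<sigma> h"] by (auto simp: painter_has_won_def)
  next
    assume "\<exists>S :: nat \<Rightarrow> 'a set. \<forall>n. lister_play G r \<sigma> (map S [0..<n])"
    then obtain S :: "nat \<Rightarrow> 'a set" where "\<And>n. lister_play G r \<sigma> (map S [0..<n])" by blast
    from len[OF this[of "Suc (card (pverts G))"]] show False by simp
  qed
  then show ?thesis unfolding paintable_def r_def by (metis le_add1 plus_1_eq_Suc)
qed

primrec f_seq :: "nat \<Rightarrow> nat \<Rightarrow> nat" where
  "f_seq m 0 = 1"
| "f_seq m (Suc r) = f_seq m r + nat \<lceil>real (f_seq m r) / (real m - 1)\<rceil>"

end

theory Submission
  imports Defs
begin

text \<open>
  Call a vertex that can still be presented j times before reaching k presentations a vertex of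
  level j, and put q = m - 1. Lister keeps accounts in tokens: q tokens at level j stand for a group
  of f(j) vertices, a single token for \<open>\<lceil>f(j) / q\<rceil>\<close> vertices. In every round Lister presents, in
  each part, one group of the lowest level r at which the part owns a group. A presented group that
  is not painted consists of \<open>f(r) = f(r-1) + \<lceil>f(r-1) / q\<rceil>\<close> vertices, hence turns q tokens of level
  r into q + 1 tokens of level r - 1. Painter can only paint inside one part, which loses q tokens
  while the other q parts gain one each, so the total number of tokens is constant. As Lister always
  plays the lowest group, no level below k ever holds more than 2q tokens, and at most one of them
  more than q. Thus no part can grow much, so no part can run out of groups, and the game goes on
  until a group reaches level 0.
\<close>

section \<open>The token accounts\<close>

text \<open>\<open>r\<close> is the level Lister plays next in the part, and \<open>W\<close> is the
  number of groups it starts with, all at level \<open>k\<close>; hence the extra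
  \<open>q * W\<close> there.\<close>

definition playable :: "nat \<Rightarrow> nat \<Rightarrow> nat \<Rightarrow> (nat \<Rightarrow> nat) \<Rightarrow> nat \<Rightarrow> bool" where
  "playable q k W t r \<longleftrightarrow> 1 \<le> r \<and> r \<le> k \<and> q \<le> t r \<and> (\<forall>j\<in>{1..<r}. t j < q) \<and>
     (\<forall>j\<le>k. t j \<le> q + (if j = r then q else 0) + (if j = k then q * W else 0))"

definition after_painting :: "nat \<Rightarrow> nat \<Rightarrow> (nat \<Rightarrow> nat) \<Rightarrow> nat \<Rightarrow> nat" where
  "after_painting q r t = t(r := t r - q)"

definition after_survival :: "nat \<Rightarrow> nat \<Rightarrow> (nat \<Rightarrow> nat) \<Rightarrow> nat \<Rightarrow> nat" where
  "after_survival q r t = t(r := t r - q, r - 1 := t (r - 1) + q + 1)"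

lemma sum_tokens_le:
  assumes "playable q k W t r"
  shows "(\<Sum>j=1..k. t j) \<le> q * (k + 1 + W)"
proof -
  have "(\<Sum>j=1..k. t j) \<le>
      (\<Sum>j=1..k. q + (if j = r then q else 0) + (if j = k then q * W else 0))"
    using assms by (intro sum_mono) (auto simp: playable_def)
  also have "\<dots> = k * q + q + q * W"
    using assms by (simp add: sum.distrib playable_def)
  finally show ?thesis by (simp add: algebra_simps)
qed

lemma sum_after_painting:
  assumes "playable q k W t r"
  shows "(\<Sum>j=1..k. after_painting q r t j) + q = (\<Sum>j=1..k. t j)"
proof -
  have r: "r \<in> {1..k}" "q \<le> t r" using assms by (auto simp: playable_def)
  have "(\<Sum>j\<in>{1..k} - {r}. after_painting q r t j) = (\<Sum>j\<in>{1..k} - {r}. t j)"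
    by (intro sum.cong) (auto simp: after_painting_def)
  moreover have "(\<Sum>j=1..k. g j) = g r + (\<Sum>j\<in>{1..k} - {r}. g j)" for g :: "nat \<Rightarrow> nat"
    using r(1) by (simp add: sum.remove)
  moreover have "after_painting q r t r + q = t r" using r(2) by (simp add: after_painting_def)
  ultimately show ?thesis by (metis add.commute add.left_commute)
qed

text \<open>The sum starts at level 1, so \<open>r > 1\<close> is what keeps the
  \<open>q + 1\<close> new tokens of level \<open>r - 1\<close> inside it.\<close>

lemma sum_after_survival:
  assumes "playable q k W t r" "r > 1"
  shows "(\<Sum>j=1..k. after_survival q r t j) = (\<Sum>j=1..k. t j) + 1"
proof -
  define A where "A = {1..k} - {r} - {r - 1}"
  have r: "r \<in> {1..k}" "r - 1 \<in> {1..k} - {r}" "q \<le> t r" using assms by (auto simp: playable_def)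
  have split: "(\<Sum>j=1..k. g j) = g r + (g (r - 1) + (\<Sum>j\<in>A. g j))" for g :: "nat \<Rightarrow> nat"
    using r(1,2) sum.remove[of "{1..k}" r g] sum.remove[of "{1..k} - {r}" "r - 1" g]
    by (simp add: A_def)
  have "(\<Sum>j\<in>A. after_survival q r t j) = (\<Sum>j\<in>A. t j)"
    by (intro sum.cong) (auto simp: after_survival_def A_def)
  then show ?thesis using r assms(2) unfolding split
    by (simp add: after_survival_def)
qed

text \<open>Level \<open>r - 1\<close> held fewer than \<open>q\<close> tokens, so it ends with at
  most \<open>2 * q\<close>, while level \<open>r\<close> gives back its extra allowance. The one
  overfull level just moves down.\<close>

lemma playable_after_survival:
  assumes "playable q k W t r" "r > 1"
  shows "playable q k W (after_survival q r t) (r - 1)"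
proof -
  have r: "r \<le> k" and low: "\<And>j. 1 \<le> j \<Longrightarrow> j < r \<Longrightarrow> t j < q"
    and up: "\<And>j. j \<le> k \<Longrightarrow> t j \<le> q + (if j = r then q else 0) + (if j = k then q * W else 0)"
    using assms(1) by (auto simp: playable_def)
  have "after_survival q r t j \<le> q + (if j = r - 1 then q else 0) + (if j = k then q * W else 0)"
    if "j \<le> k" for j
  proof -
    consider "j = r" | "j = r - 1" | "j \<noteq> r" "j \<noteq> r - 1" by blast
    then show ?thesis
    proof cases
      case 1 then show ?thesis using up[of r] r assms(2) by (auto simp: after_survival_def)
    next
      case 2
      have "t (r - 1) < q" using assms(2) by (intro low) auto
      then show ?thesis using 2 r assms(2) by (simp add: after_survival_def)
    next
      case 3 then show ?thesis using up[OF that] by (auto simp: after_survival_def)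
    qed
  qed
  moreover have "\<forall>j\<in>{1..<r - 1}. after_survival q r t j < q"
    using low by (auto simp: after_survival_def)
  ultimately show ?thesis using r assms(2)
    by (auto simp: playable_def) (simp add: after_survival_def)
qed

text \<open>Losing \<open>q\<close> tokens at the overfull level makes the upper bounds hold for
  every choice of \<open>r'\<close>. Pigeonhole over the \<open>k\<close> levels then yields one
  with \<open>q\<close> tokens, and the least such level serves.\<close>

lemma playable_after_painting:
  assumes "playable q k W t r" and "(\<Sum>j=1..k. after_painting q r t j) > k * (q - 1)"
  shows "\<exists>r'. playable q k W (after_painting q r t) r'"
proof -
  let ?t = "after_painting q r t"
  let ?P = "\<lambda>j. j \<in> {1..k} \<and> q \<le> ?t j"
  have up: "?t j \<le> q + (if j = k then q * W else 0)" if "j \<le> k" for j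
    using assms(1) that by (auto simp: playable_def after_painting_def split: if_splits)
  have "\<exists>j. ?P j"
  proof (rule ccontr)
    assume "\<not> ?thesis"
    then have "(\<Sum>j=1..k. ?t j) \<le> (\<Sum>j=1..k. q - 1)" by (intro sum_mono) force
    with assms(2) show False by simp
  qed
  then have "?P (LEAST j. ?P j)" by (rule LeastI_ex)
  moreover have "\<forall>j\<in>{1..<LEAST j. ?P j}. ?t j < q"
  proof
    fix j assume j: "j \<in> {1..<LEAST j. ?P j}"
    then have "\<not> ?P j" using not_less_Least by auto
    with j calculation show "?t j < q" by auto
  qed
  moreover have "?t j \<le> q + (if j = r' then q else 0) + (if j = k then q * W else 0)"
    if "j \<le> k" for j r'
    using up[OF that] by (simp split: if_splits)
  ultimately have "playable q k W ?t (LEAST j. ?P j)"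
    unfolding playable_def by simp
  then show ?thesis by blast
qed

text \<open>The total is conserved and the \<open>q\<close> parts other than \<open>p\<close> have
  bounded token counts, so \<open>p\<close> retains enough tokens to own a group.\<close>

lemma playable_step:
  fixes q k W m p :: nat and t :: "nat \<Rightarrow> nat \<Rightarrow> nat" and r :: "nat \<Rightarrow> nat"
  assumes m: "m = Suc q" and q: "q \<ge> 1" and W: "W = m * (k + 1)" and p: "p < m"
    and playable: "\<And>i. i < m \<Longrightarrow> playable q k W (t i) (r i)"
    and r: "\<And>i. i < m \<Longrightarrow> i \<noteq> p \<Longrightarrow> r i > 1"
    and total: "(\<Sum>i<m. \<Sum>j=1..k. t i j) = m * q * W"
  defines "t' \<equiv> \<lambda>i. if i = p then after_painting q (r i) (t i) else after_survival q (r i) (t i)"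
  shows "(\<Sum>i<m. \<Sum>j=1..k. t' i j) = m * q * W"
    and "\<exists>r'. \<forall>i<m. playable q k W (t' i) (r' i)"
proof -
  let ?V = "\<lambda>t i. \<Sum>j=1..k. t i j"
  let ?A = "{..<m} - {p}"
  have split: "(\<Sum>i<m. g i) = g p + (\<Sum>i\<in>?A. g i)" for g :: "nat \<Rightarrow> nat"
    using p by (simp add: sum.remove)
  have card: "card ?A = q" using p m by simp
  have others: "?V t' i = ?V t i + 1" if "i \<in> ?A" for i
    using that sum_after_survival[OF playable r, of i] by (simp add: t'_def)
  have "(\<Sum>i\<in>?A. ?V t' i) = (\<Sum>i\<in>?A. ?V t i + 1)"
    by (rule sum.cong[OF refl others])
  also have "\<dots> = (\<Sum>i\<in>?A. ?V t i) + q"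
    unfolding sum.distrib using card by simp
  finally have "(\<Sum>i\<in>?A. ?V t' i) = (\<Sum>i\<in>?A. ?V t i) + q" .
  moreover have "?V t' p + q = ?V t p"
    using sum_after_painting[OF playable[OF p]] by (simp add: t'_def)
  ultimately show total': "(\<Sum>i<m. ?V t' i) = m * q * W"
    using total unfolding split by simp
  have survivors: "playable q k W (t' i) (r i - 1)" if "i \<in> ?A" for i
    using that playable_after_survival[OF playable r, of i] by (simp add: t'_def)
  have "(\<Sum>i\<in>?A. ?V t' i) \<le> (\<Sum>i\<in>?A. q * (k + 1 + W))"
    by (intro sum_mono sum_tokens_le[OF survivors])
  also have "\<dots> = q * (q * (k + 1 + W))" using card by simp
  finally have "m * q * W \<le> ?V t' p + q * (q * (k + 1 + W))"
    using total' unfolding split by simp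
  \<comment> \<open>This dictates the size of \<open>W\<close>: as \<open>m - q = 1\<close>, the
    choice \<open>W = m * (k + 1)\<close> leaves exactly \<open>q * (k + 1)\<close> tokens for part
    \<open>p\<close>.\<close>
  moreover have "m * q * W = q * (k + 1) + q * (q * (k + 1 + W))"
    unfolding W m by (simp add: algebra_simps)
  ultimately have "q * (k + 1) \<le> ?V t' p" by simp
  moreover have "k * (q - 1) < q * (k + 1)"
  proof -
    have "k * (q - 1) \<le> k * q" by simp
    also have "\<dots> < q * (k + 1)" using q by (simp add: algebra_simps)
    finally show ?thesis .
  qed
  ultimately have "k * (q - 1) < ?V t' p" by linarith
  then obtain rp where "playable q k W (t' p) rp"
    using playable_after_painting[OF playable[OF p]] by (auto simp: t'_def)
  then have "\<forall>i<m. playable q k W (t' i) (if i = p then rp else r i - 1)"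
    using survivors by auto
  then show "\<exists>r'. \<forall>i<m. playable q k W (t' i) (r' i)"
    by (rule exI[of _ "\<lambda>i. if i = p then rp else r i - 1"])
qed

section \<open>Exchange rate between tokens and vertices\<close>

definition increment :: "nat \<Rightarrow> nat \<Rightarrow> nat" where
  "increment m j = nat \<lceil>real (f_seq m j) / (real m - 1)\<rceil>"

lemma f_seq_Suc: "f_seq m (Suc j) = f_seq m j + increment m j"
  by (simp add: increment_def)

lemma f_seq_pos: "f_seq m j > 0"
  by (induction j) auto

lemma f_seq_le_increment:
  assumes "q \<ge> 1"
  shows "f_seq (Suc q) j \<le> q * increment (Suc q) j"
proof -
  have "real (f_seq (Suc q) j) / real q \<le> real (increment (Suc q) j)"
    unfolding increment_def by (simp add: real_nat_ceiling_ge)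
  then have "real (f_seq (Suc q) j) \<le> real (q * increment (Suc q) j)"
    using assms by (simp add: field_simps)
  then show ?thesis by (simp only: of_nat_le_iff)
qed

text \<open>Tokens are bundled into as many groups as possible; by \<open>f_seq_le_increment\<close>
  a bundle never costs more than \<open>q\<close> loose tokens.\<close>

definition worth :: "nat \<Rightarrow> nat \<Rightarrow> nat \<Rightarrow> nat" where
  "worth q j t = (t div q) * f_seq (Suc q) j + (t mod q) * increment (Suc q) j"

lemma worth_add:
  assumes "q \<ge> 1"
  shows "worth q j (t + q) = worth q j t + f_seq (Suc q) j"
  using assms by (simp add: worth_def)

lemma worth_diff:
  assumes "q \<ge> 1" "q \<le> t"
  shows "worth q j (t - q) = worth q j t - f_seq (Suc q) j" "f_seq (Suc q) j \<le> worth q j t"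
  using worth_add[OF assms(1), of j "t - q"] assms(2) by auto

text \<open>The new token either stays loose or completes a bundle, and bundling cannot raise the
  cost.\<close>

lemma worth_Suc_le:
  assumes "q \<ge> 1"
  shows "worth q j (Suc t) \<le> worth q j t + increment (Suc q) j"
proof (cases "Suc (t mod q) = q")
  case True
  then have "q * increment (Suc q) j = (t mod q) * increment (Suc q) j + increment (Suc q) j"
    by (metis add.commute mult_Suc)
  with True show ?thesis using f_seq_le_increment[OF assms, of j]
    by (simp add: worth_def div_Suc mod_Suc)
next
  case False
  then show ?thesis by (simp add: worth_def div_Suc mod_Suc)
qed

section \<open>The game\<close>

lemma finite_unpainted:
  "finite (unpainted (complete_multipartite a b) \<sigma> h)"
  by (rule finite_subset[of _ "{..<b} \<times> {..<a}"])
     (auto simp: unpainted_def complete_multipartite_def)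

lemma unpainted_append:
  "unpainted G \<sigma> (h @ [S]) = unpainted G \<sigma> h - \<sigma> (h @ [S])"
  by (auto simp: unpainted_def lessThan_Suc)

lemma presentations_append:
  "presentations (h @ [S]) v = presentations h v + (if v \<in> S then 1 else 0)"
proof -
  have "{i. i < length (h @ [S]) \<and> v \<in> (h @ [S]) ! i} =
      {i. i < length h \<and> v \<in> h ! i} \<union> (if v \<in> S then {length h} else {})"
    by (auto simp: nth_append less_Suc_eq)
  then show ?thesis
    by (simp add: presentations_def card_Un_disjoint del: length_append)
qed

lemma independent_set_in_part:
  assumes "independent_set (complete_multipartite a b) I" "b > 0"
  obtains p where "p < b" "\<And>v. v \<in> I \<Longrightarrow> fst v = p"
proof (cases "I = {}")
  case True then show ?thesis using assms(2) that by blast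
next
  case False
  then obtain u where u: "u \<in> I" by blast
  with assms(1) have "fst u < b"
    by (auto simp: independent_set_def complete_multipartite_def)
  moreover have "fst v = fst u" if "v \<in> I" for v
    using assms(1) u that unfolding independent_set_def complete_multipartite_def by fastforce
  ultimately show ?thesis using that by blast
qed

text \<open>A history won by Lister cannot be extended, so a winning strategy would make Painter the
  winner of it as well, yet an unpainted vertex remains.\<close>

lemma not_lister_has_won:
  assumes "painter_winning_strategy G s \<sigma>" "lister_play G s \<sigma> h"
  shows "\<not> lister_has_won G s \<sigma> h"
proof
  assume won: "lister_has_won G s \<sigma> h"
  then have "\<nexists>S. lister_play G s \<sigma> (h @ [S])"
    by (auto elim: lister_play.cases)
  then have "painter_has_won G \<sigma> h"
    using assms by (auto simp: painter_winning_strategy_def)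
  with won show False by (simp add: lister_has_won_def painter_has_won_def)
qed

lemma infinite_play:
  assumes "P []" and step: "\<And>h. P h \<Longrightarrow> \<exists>x. P (h @ [x])"
  shows "\<exists>X :: nat \<Rightarrow> 'a. \<forall>n. P (map X [0..<n])"
proof -
  define H where "H = rec_nat [] (\<lambda>_ h. h @ [SOME x. P (h @ [x])])"
  have H: "H 0 = []" "\<And>n. H (Suc n) = H n @ [SOME x. P (H n @ [x])]"
    by (simp_all add: H_def)
  have "P (H n)" for n
    by (induction n) (auto simp: H assms(1) intro: someI_ex[OF step])
  moreover have "map (\<lambda>n. last (H (Suc n))) [0..<n] = H n" for n
    by (induction n) (simp_all add: H)
  ultimately show ?thesis by metis
qed

text \<open>Writing \<open>presentations h v + j = k\<close> instead of a truncated difference keeps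
  vertices presented more than \<open>k\<close> times out of level 0.\<close>

definition level :: "(nat \<times> nat) pair_pre_digraph \<Rightarrow> ((nat \<times> nat) set list \<Rightarrow> (nat \<times> nat) set) \<Rightarrow>
    nat \<Rightarrow> (nat \<times> nat) set list \<Rightarrow> nat \<Rightarrow> nat \<Rightarrow> (nat \<times> nat) set" where
  "level G \<sigma> k h i j = {v \<in> unpainted G \<sigma> h. fst v = i \<and> presentations h v + j = k}"

lemma level_append:
  assumes "\<sigma> (h @ [S]) \<subseteq> S"
  shows "level G \<sigma> k h i j - S \<subseteq> level G \<sigma> k (h @ [S]) i j"
    and "(level G \<sigma> k h i (Suc j) \<inter> S) - \<sigma> (h @ [S]) \<subseteq> level G \<sigma> k (h @ [S]) i j"
  using assms by (auto simp: level_def unpainted_append presentations_append)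

text \<open>One round of Lister's strategy: \<open>stock\<close> says that real vertices back the
  tokens, and all invariants survive Painter's reply.\<close>

lemma play_continues:
  fixes q k W m s a :: nat and h :: "(nat \<times> nat) set list"
  defines "G \<equiv> complete_multipartite a m"
  assumes m: "m = Suc q" and q: "q \<ge> 1" and W: "W = m * (k + 1)" and s: "s \<le> k"
    and winning: "painter_winning_strategy G s \<sigma>"
    and play: "lister_play G s \<sigma> h"
    and playable: "\<And>i. i < m \<Longrightarrow> playable q k W (t i) (r i)"
    and total: "(\<Sum>i<m. \<Sum>j=1..k. t i j) = m * q * W"
    and stock: "\<And>i j. i < m \<Longrightarrow> j \<in> {1..k} \<Longrightarrow> worth q j (t i j) \<le> card (level G \<sigma> k h i j)"
  shows "\<exists>S t' r'. lister_play G s \<sigma> (h @ [S]) \<and> (\<forall>i<m. playable q k W (t' i) (r' i)) \<and>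
    (\<Sum>i<m. \<Sum>j=1..k. t' i j) = m * q * W \<and>
    (\<forall>i<m. \<forall>j\<in>{1..k}. worth q j (t' i j) \<le> card (level G \<sigma> k (h @ [S]) i j))"
proof -
  let ?f = "f_seq m" and ?L = "level G \<sigma> k h"
  have finL: "finite (level G \<sigma> k h' i j)" for h' i j
    unfolding level_def G_def using finite_unpainted by simp
  have rk: "1 \<le> r i" "r i \<le> k" "q \<le> t i (r i)" if "i < m" for i
    using playable[OF that] by (auto simp: playable_def)
  have "\<exists>B. B \<subseteq> ?L i (r i) \<and> card B = ?f (r i)" if "i < m" for i
    using stock[OF that, of "r i"] worth_diff(2)[OF q rk(3)[OF that], of "r i"] rk[OF that] m
    by (metis obtain_subset_with_card_n le_trans atLeastAtMost_iff)
  then obtain B where B: "\<And>i. i < m \<Longrightarrow> B i \<subseteq> ?L i (r i)" "\<And>i. i < m \<Longrightarrow> card (B i) = ?f (r i)"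
    by metis
  have finB: "finite (B i)" if "i < m" for i using B(1)[OF that] finL finite_subset by blast
  have neB: "B i \<noteq> {}" if "i < m" for i using B(2)[OF that] f_seq_pos[of m "r i"] by auto
  define S where "S = (\<Union>i<m. B i)"
  have S: "S \<noteq> {}" "S \<subseteq> unpainted G \<sigma> h"
    using neB[of 0] m B(1) by (auto simp: S_def level_def)
  have LS: "?L i j \<inter> S = (if j = r i then B i else {})" if "i < m" for i j
  proof -
    have "B i' \<inter> ?L i j = {}" if "i' < m" "i' \<noteq> i \<or> j \<noteq> r i" for i'
      using B(1)[OF that(1)] that(2) by (fastforce simp: level_def)
    then show ?thesis using B(1)[OF that] that by (auto simp: S_def)
  qed
  have "\<not> painter_has_won G \<sigma> h" using S by (auto simp: painter_has_won_def)
  with play S have play': "lister_play G s \<sigma> (h @ [S])"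
    using not_lister_has_won[OF winning] by (intro lister_play.round) auto
  then have legal: "\<sigma> (h @ [S]) \<subseteq> S" "independent_set G (\<sigma> (h @ [S]))"
    using winning by (auto simp: painter_winning_strategy_def)
  \<comment> \<open>Part \<open>p\<close> will write off its whole group, even if Painter paints
    only some of it or nothing; \<open>stock\<close> is merely a lower bound.\<close>
  obtain p where p: "p < m" and painted: "\<And>v. v \<in> \<sigma> (h @ [S]) \<Longrightarrow> fst v = p"
    using independent_set_in_part legal(2) m unfolding G_def by blast
  have move: "?L i j - S \<subseteq> level G \<sigma> k (h @ [S]) i j"
    "(?L i (Suc j) \<inter> S) - \<sigma> (h @ [S]) \<subseteq> level G \<sigma> k (h @ [S]) i j" for i j
    using level_append[where \<sigma> = \<sigma> and h = h and S = S] legal(1) by blast+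
  have kept: "?L i j - (if j = r i then B i else {}) \<subseteq> level G \<sigma> k (h @ [S]) i j" if "i < m" for i j
    using move(1)[of i j] LS[OF that, of j] by blast
  have fresh: "B i \<subseteq> level G \<sigma> k (h @ [S]) i (r i - 1)" if "i < m" "i \<noteq> p" for i
  proof -
    have "B i \<inter> \<sigma> (h @ [S]) = {}"
      using painted B(1)[OF that(1)] that(2) by (force simp: level_def)
    then show ?thesis using move(2)[of i "r i - 1"] LS[OF that(1), of "r i"] rk[OF that(1)] by auto
  qed
  \<comment> \<open>A surviving group of level 1 would reach level 0, where vertices have been
    presented \<open>k\<close> times, and \<open>s \<le> k\<close> makes that a win for
    Lister.\<close>
  have r1: "r i > 1" if i: "i < m" "i \<noteq> p" for i
  proof (rule ccontr)
    assume "\<not> ?thesis"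
    with fresh[OF i] neB[OF i(1)] obtain v where "v \<in> level G \<sigma> k (h @ [S]) i 0" by force
    then have "lister_has_won G s \<sigma> (h @ [S])"
      using s by (auto simp: level_def lister_has_won_def)
    then show False using not_lister_has_won[OF winning play'] by blast
  qed
  define t' where "t' \<equiv> \<lambda>i. if i = p then after_painting q (r i) (t i)
    else after_survival q (r i) (t i)"
  have step: "(\<Sum>i<m. \<Sum>j=1..k. t' i j) = m * q * W" "\<exists>r'. \<forall>i<m. playable q k W (t' i) (r' i)"
    using playable_step[OF m q W p playable r1 total] unfolding t'_def by auto
  have "worth q j (t' i j) \<le> card (level G \<sigma> k (h @ [S]) i j)" if i: "i < m" and j: "j \<in> {1..k}" for i j
  proof -
    have remaining: "card (?L i j - (if j = r i then B i else {})) =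
        card (?L i j) - (if j = r i then ?f (r i) else 0)"
      using B[OF i] finB[OF i] by (simp add: card_Diff_subset)
    consider "j = r i" | "i \<noteq> p" "Suc j = r i" | "j \<noteq> r i" "\<not> (i \<noteq> p \<and> Suc j = r i)" by blast
    then show ?thesis
    proof cases
      case 1
      then have "t' i j = t i j - q" using rk(1)[OF i]
        by (auto simp: t'_def after_painting_def after_survival_def)
      then show ?thesis
        using worth_diff(1)[OF q, of "t i j" j] rk(3)[OF i] 1 stock[OF i j] remaining
          card_mono[OF finL kept[OF i, of j]] m by simp
    next
      case 2
      have "t' i j = Suc (t i j) + q"
        using 2 by (auto simp: t'_def after_survival_def)
      \<comment> \<open>The recursion for \<open>f_seq\<close> enters here: a group of level
        \<open>Suc j\<close> has exactly the vertices to pay for a group and one loose token at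
        level \<open>j\<close>.\<close>
      then have "worth q j (t' i j) \<le> card (?L i j) + ?f (r i)"
        using worth_add[OF q, of j "Suc (t i j)"] worth_Suc_le[OF q, of j "t i j"]
          stock[OF i j] f_seq_Suc[of m j] 2 m by simp
      also have "\<dots> = card (?L i j \<union> B i)"
        using 2 B[OF i] finL finB[OF i]
        by (subst card_Un_disjoint) (auto simp: level_def)
      also have "\<dots> \<le> card (level G \<sigma> k (h @ [S]) i j)"
        using kept[OF i, of j] fresh[OF i] 2(1) 2(2)[symmetric] by (intro card_mono finL) simp
      finally show ?thesis .
    next
      case 3
      then have "i = p \<or> j \<noteq> r i - 1" using j by fastforce
      with 3(1) have "t' i j = t i j"
        unfolding t'_def after_painting_def after_survival_def
        by (simp only: fun_upd_apply if_False split: if_split) blast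
      moreover have "card (?L i j) \<le> card (level G \<sigma> k (h @ [S]) i j)"
        using kept[OF i, of j] 3(1) by (intro card_mono finL) simp
      ultimately show ?thesis using stock[OF i j] by simp
    qed
  qed
  then show ?thesis
    using play' step by blast
qed

text \<open>Against a winning Painter the invariants let Lister play forever, but a winning strategy
  excludes infinite plays. Allowing every \<open>s \<le> k\<close> lets the result apply to the
  paintability itself.\<close>

lemma not_paintable:
  fixes m k s :: nat
  assumes m: "m \<ge> 2" and k: "k \<ge> 1" and s: "s \<le> k"
  shows "\<not> paintable (complete_multipartite (m * (k + 1) * f_seq m k) m) s"
proof
  define W where "W = m * (k + 1)"
  define q where "q = m - 1"
  have mq: "m = Suc q" "q \<ge> 1" using m by (auto simp: q_def)
  define G where "G = complete_multipartite (W * f_seq m k) m"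
  assume "paintable (complete_multipartite (m * (k + 1) * f_seq m k) m) s"
  then obtain \<sigma> where win: "painter_winning_strategy G s \<sigma>"
    by (auto simp: paintable_def G_def W_def)
  define P where "P h \<longleftrightarrow> lister_play G s \<sigma> h \<and> (\<exists>t r. (\<forall>i<m. playable q k W (t i) (r i)) \<and>
    (\<Sum>i<m. \<Sum>j=1..k. t i j) = m * q * W \<and>
    (\<forall>i<m. \<forall>j\<in>{1..k}. worth q j (t i j) \<le> card (level G \<sigma> k h i j)))" for h
  have "P []"
  proof -
    \<comment> \<open>Each part starts as \<open>W\<close> groups of \<open>f_seq m k\<close>
      vertices at level \<open>k\<close>, which is exactly its size.\<close>
    define t where "t i j = (if j = k then q * W else 0)" for i j :: nat
    have "W \<ge> 1" using m by (simp add: W_def)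
    then have "playable q k W (t i) k" for i using k mq by (auto simp: playable_def t_def)
    moreover have "(\<Sum>i<m. \<Sum>j=1..k. t i j) = m * q * W"
      using k by (simp add: t_def)
    moreover have "worth q j (t i j) \<le> card (level G \<sigma> k [] i j)" if "i < m" for i j
    proof (cases "j = k")
      case True
      have "level G \<sigma> k [] i k = {i} \<times> {..<W * f_seq m k}"
        using that by (auto simp: level_def unpainted_def presentations_def G_def
            complete_multipartite_def)
      then show ?thesis using True mq by (simp add: worth_def t_def card_cartesian_product)
    next
      case False then show ?thesis by (simp add: worth_def t_def)
    qed
    ultimately show ?thesis unfolding P_def
      by (intro conjI lister_play.start exI[of _ t] exI[of _ "\<lambda>_. k"]) auto
  qed
  moreover have "\<exists>S. P (h @ [S])" if "P h" for h
  proof -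
    from that obtain t r where "lister_play G s \<sigma> h"
      and "\<And>i. i < m \<Longrightarrow> playable q k W (t i) (r i)"
      and "(\<Sum>i<m. \<Sum>j=1..k. t i j) = m * q * W"
      and "\<And>i j. i < m \<Longrightarrow> j \<in> {1..k} \<Longrightarrow> worth q j (t i j) \<le> card (level G \<sigma> k h i j)"
      unfolding P_def by blast
    from play_continues[OF mq W_def s win[unfolded G_def] this[unfolded G_def], folded G_def]
    show ?thesis unfolding P_def by blast
  qed
  ultimately obtain X where "\<forall>n. P (map X [0..<n])" using infinite_play[of P] by blast
  then show False using win unfolding P_def painter_winning_strategy_def by blast
qed

theorem theorem3p9:
  fixes m k :: nat
  assumes "m \<ge> 2" and "k \<ge> 2"
  shows "paintability (complete_multipartite (m * (k + 1) * f_seq m k) m) > k"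
proof (rule ccontr)
  let ?G = "complete_multipartite (m * (k + 1) * f_seq m k) m"
  assume "\<not> ?thesis"
  moreover have "paintable ?G (paintability ?G)"
    using LeastI_ex[OF ex_paintable[OF pair_graph_complete_multipartite]]
    unfolding paintability_def by blast
  ultimately show False using not_paintable[of m k] assms by simp
qed

end
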